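(* Let $X$ be a metric space, $\varphi_1,\varphi_2\colon X\to\mathbb{R}_\infty$, and $U\subset X$ with $\operatorname{dom}\varphi_1\cap\operatorname{dom}\varphi_2\cap U\ne\emptyset$. For sequences $\{x_k\},\{x_{1k}\},\{x_{2k}\}\subset X$ with $x_{1k}\in\operatorname{dom}\varphi_1$, $x_{2k}\in\operatorname{dom}\varphi_2$ consider the conditions $$\text{(a)}\ \lim_{k\to+\infty}d(x_k,x_{1k})=\lim_{k\to+\infty}d(x_k,x_{2k})=0,\qquad\text{(b)}\ \limsup_{k\to+\infty}\bigl((\varphi_1+\varphi_2)(x_k)-\varphi_1(x_{1k})-\varphi_2(x_{2k})\bigr)\le0.$$ The pair $(\varphi_1,\varphi_2)$ is (i) uniformly lower semicontinuous on $U$ if and only if, for any sequences $\{x_{1k}\}\subset\operatorname{dom}\varphi_1\cap U$ and $\{x_{2k}\}\subset\operatorname{dom}\varphi_2\cap U$ satisfying $d(x_{1k},x_{2k})\to0$ as $k\to+\infty$, there exists a sequence $\{x_k\}\subset U$ such that (b) is satisfied; (ii) quasiuniformly lower semicontinuous on $U$ if and only if, for any sequences $\{x_{1k}\}\subset\operatorname{dom}\varphi_1\cap U$ and $\{x_{2k}\}\subset\operatorname{dom}\varphi_2$ satisfying $\{x_{1k}\}\in EI(U)$ and $d(x_{1k},x_{2k})\to0$ as $k\to+\infty$, there exists a sequence $\{x_k\}\subset U$ such that (b) is satisfied; (iii) firmly uniformly lower semicontinuous on $U$ if and only if, for any sequences $\{x_{1k}\}\subset\operatorname{dom}\varphi_1\cap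 U$ and $\{x_{2k}\}\subset\operatorname{dom}\varphi_2\cap U$ satisfying $d(x_{1k},x_{2k})\to0$ as $k\to+\infty$, there exists a sequence $\{x_k\}\subset U$ such that (a) and (b) are satisfied; (iv) firmly quasiuniformly lower semicontinuous on $U$ if and only if, for any sequences $\{x_{1k}\}\subset\operatorname{dom}\varphi_1\cap U$ and $\{x_{2k}\}\subset\operatorname{dom}\varphi_2$ satisfying $\{x_{1k}\}\in EI(U)$ and $d(x_{1k},x_{2k})\to0$ as $k\to+\infty$, there exists a sequence $\{x_k\}\subset X$ such that (a) and (b) are satisfied.
   Context: $\mathbb{R}_\infty:=\mathbb{R}\cup\{+\infty\}$, $\operatorname{dom}\varphi:=\{x\mid\varphi(x)<+\infty\}$, $\inf\emptyset=+\infty$. A set $V\subset X$ is an essentially interior subset of $U$ if $\bigcup_{x\in V}B_\rho(x)\subset U$ for some $\rho>0$ ($B_\rho$ = open ball); $EI(U)$ is the collection of all such $V$ (including $\emptyset$); $\{x_{1k}\}\in EI(U)$ means that the set of terms of the sequence belongs to $EI(U)$. A liminf (limsup) as $d(x_1,x_2)\to0$ over indicated pairs means $\lim_{\eta\downarrow0}$ of the infimum (supremum) over such pairs with $d(x_1,x_2)<\eta$. Put $$\Lambda_U^\circ(\varphi_1,\varphi_2):=\liminf_{d(x_1,x_2)\to0;\;x_1,x_2\in U}(\varphi_1(x_1)+\varphi_2(x_2)),\qquad \Lambda_U^\dagger(\varphi_1,\varphi_2):=\inf_{V\in EI(U)}\Lambda_V^\circ(\varphi_1,\varphi_2),$$ $$(\varphi_1\diamondsuit\varphi_2)_U(x_1,x_2):=\inf_{x\in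 U}\max\{d(x,x_1),\,d(x,x_2),\,(\varphi_1+\varphi_2)(x)-\varphi_1(x_1)-\varphi_2(x_2)\}\quad(x_1\in\operatorname{dom}\varphi_1,\ x_2\in\operatorname{dom}\varphi_2),$$ $$\Theta_U^\circ(\varphi_1,\varphi_2):=\limsup_{\substack{d(x_1,x_2)\to0\\ x_1\in\operatorname{dom}\varphi_1\cap U,\,x_2\in\operatorname{dom}\varphi_2\cap U}}(\varphi_1\diamondsuit\varphi_2)_U(x_1,x_2),\quad \Theta_U^\dagger(\varphi_1,\varphi_2):=\sup_{V\in EI(U)}\ \limsup_{\substack{d(x_1,x_2)\to0\\ x_1\in\operatorname{dom}\varphi_1\cap V,\,x_2\in\operatorname{dom}\varphi_2\cap V}}(\varphi_1\diamondsuit\varphi_2)_U(x_1,x_2),$$ with the supremum of the (nonnegative) quantity $\diamondsuit$ over an empty set being $0$. The pair $(\varphi_1,\varphi_2)$ is, on $U$: uniformly lower semicontinuous if $\inf_U(\varphi_1+\varphi_2)\le\Lambda_U^\circ(\varphi_1,\varphi_2)$; quasiuniformly lower semicontinuous if $\inf_U(\varphi_1+\varphi_2)\le\Lambda_U^\dagger(\varphi_1,\varphi_2)$; firmly uniformly lower semicontinuous if $\Theta_U^\circ(\varphi_1,\varphi_2)=0$; firmly quasiuniformly lower semicontinuous if $\Theta_U^\dagger(\varphi_1,\varphi_2)=0$. *)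

theory Defs
  imports "HOL-Analysis.Analysis"
begin

text \<open>A function into the reals extended by \<open>+\<infinity>\<close> is an \<^typ>\<open>ereal\<close>-valued function that never
  takes the value \<open>-\<infinity>\<close>; the latter is a hypothesis of the theorem and is not built
  into the definitions below.\<close>

definition edom :: "('a \<Rightarrow> ereal) \<Rightarrow> 'a set" where
  "edom \<phi> = {x. \<phi> x < \<infinity>}"

definition EI :: "'a::metric_space set \<Rightarrow> 'a set set" where
  "EI U = {V. \<exists>\<rho>>0. (\<Union>x\<in>V. ball x \<rho>) \<subseteq> U}"

definition close_pairs :: "'a::metric_space set \<Rightarrow> 'a set \<Rightarrow> real \<Rightarrow> ('a \<times> 'a) set" where
  "close_pairs A B \<eta> = {(x1, x2). x1 \<in> A \<and> x2 \<in> B \<and> dist x1 x2 < \<eta>}"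

definition dist_liminf ::
  "'a::metric_space set \<Rightarrow> 'a set \<Rightarrow> ('a \<Rightarrow> 'a \<Rightarrow> ereal) \<Rightarrow> ereal" where
  "dist_liminf A B f =
     Lim (at_right 0) (\<lambda>\<eta>. INF (x1, x2) \<in> close_pairs A B \<eta>. f x1 x2)"

text \<open>The upper limit is only used for nonnegative \<open>f\<close>. Inserting \<open>0\<close> has no effect on
  the supremum over a nonempty set of pairs; it makes the supremum over the empty set \<open>0\<close>
  instead of the \<open>-\<infinity>\<close> of \<^typ>\<open>ereal\<close>.\<close>

definition dist_limsup ::
  "'a::metric_space set \<Rightarrow> 'a set \<Rightarrow> ('a \<Rightarrow> 'a \<Rightarrow> ereal) \<Rightarrow> ereal" where
  "dist_limsup A B f =
     Lim (at_right 0) (\<lambda>\<eta>. Sup (insert 0 ((\<lambda>(x1, x2). f x1 x2) ` close_pairs A B \<eta>)))"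

text \<open>Both limits always exist, by monotonicity in \<open>\<eta>\<close>.\<close>

lemma close_pairs_mono: "\<eta> \<le> \<eta>' \<Longrightarrow> close_pairs A B \<eta> \<subseteq> close_pairs A B \<eta>'"
  by (auto simp: close_pairs_def)

lemma dist_liminf_eq_SUP:
  "dist_liminf A B f = (SUP \<eta>\<in>{0<..}. INF (x1, x2) \<in> close_pairs A B \<eta>. f x1 x2)"
proof -
  let ?g = "\<lambda>\<eta>. INF (x1, x2) \<in> close_pairs A B \<eta>. f x1 x2"
  have anti: "?g \<eta>' \<le> ?g \<eta>" if "\<eta> \<le> \<eta>'" for \<eta> \<eta>'
    using close_pairs_mono[OF that] by (intro INF_superset_mono) auto
  have "(?g \<longlongrightarrow> (SUP \<eta>\<in>{0<..}. ?g \<eta>)) (at_right 0)"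
  proof (rule order_tendstoI)
    fix a assume "a < (SUP \<eta>\<in>{0<..}. ?g \<eta>)"
    then obtain e where e: "e > 0" "a < ?g e"
      by (auto simp: less_SUP_iff)
    show "\<forall>\<^sub>F \<eta> in at_right 0. a < ?g \<eta>"
      unfolding eventually_at_right_field
      using e anti by (meson less_le_trans less_imp_le)
  next
    fix a assume a: "(SUP \<eta>\<in>{0<..}. ?g \<eta>) < a"
    have "?g \<eta> < a" if "\<eta> > 0" for \<eta>
      using SUP_upper[of \<eta> "{0<..}" ?g] that a by (auto intro: le_less_trans)
    then show "\<forall>\<^sub>F \<eta> in at_right 0. ?g \<eta> < a"
      unfolding eventually_at_right_field by (intro exI[of _ 1]) auto
  qed
  then show ?thesis
    unfolding dist_liminf_def by (intro tendsto_Lim) auto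
qed

lemma dist_limsup_eq_INF:
  "dist_limsup A B f =
     (INF \<eta>\<in>{0<..}. Sup (insert 0 ((\<lambda>(x1, x2). f x1 x2) ` close_pairs A B \<eta>)))"
proof -
  let ?g = "\<lambda>\<eta>. Sup (insert 0 ((\<lambda>(x1, x2). f x1 x2) ` close_pairs A B \<eta>))"
  have mono: "?g \<eta> \<le> ?g \<eta>'" if "\<eta> \<le> \<eta>'" for \<eta> \<eta>'
    using close_pairs_mono[OF that] by (intro Sup_subset_mono insert_mono image_mono)
  have "(?g \<longlongrightarrow> (INF \<eta>\<in>{0<..}. ?g \<eta>)) (at_right 0)"
  proof (rule order_tendstoI)
    fix a assume "(INF \<eta>\<in>{0<..}. ?g \<eta>) < a"
    then obtain e where e: "e > 0" "?g e < a"
      by (auto simp: INF_less_iff)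
    show "\<forall>\<^sub>F \<eta> in at_right 0. ?g \<eta> < a"
      unfolding eventually_at_right_field
      using e mono by (meson le_less_trans less_imp_le)
  next
    fix a assume a: "a < (INF \<eta>\<in>{0<..}. ?g \<eta>)"
    have "a < ?g \<eta>" if "\<eta> > 0" for \<eta>
      using INF_lower[of \<eta> "{0<..}" ?g] that a by (auto intro: less_le_trans)
    then show "\<forall>\<^sub>F \<eta> in at_right 0. a < ?g \<eta>"
      unfolding eventually_at_right_field by (intro exI[of _ 1]) auto
  qed
  then show ?thesis
    unfolding dist_limsup_def by (intro tendsto_Lim) auto
qed

definition Lambda_circ ::
  "'a::metric_space set \<Rightarrow> ('a \<Rightarrow> ereal) \<Rightarrow> ('a \<Rightarrow> ereal) \<Rightarrow> ereal" where
  "Lambda_circ U \<phi>1 \<phi>2 = dist_liminf U U (\<lambda>x1 x2. \<phi>1 x1 + \<phi>2 x2)"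

definition Lambda_dag ::
  "'a::metric_space set \<Rightarrow> ('a \<Rightarrow> ereal) \<Rightarrow> ('a \<Rightarrow> ereal) \<Rightarrow> ereal" where
  "Lambda_dag U \<phi>1 \<phi>2 = (INF V\<in>EI U. Lambda_circ V \<phi>1 \<phi>2)"

text \<open>Meaningful for \<open>x1 \<in> edom \<phi>1\<close> and \<open>x2 \<in> edom \<phi>2\<close>, the only arguments at which it is
  used: the subtracted values are then finite.\<close>

definition diamond ::
  "'a::metric_space set \<Rightarrow> ('a \<Rightarrow> ereal) \<Rightarrow> ('a \<Rightarrow> ereal) \<Rightarrow> 'a \<Rightarrow> 'a \<Rightarrow> ereal" where
  "diamond U \<phi>1 \<phi>2 x1 x2 =
     (INF x\<in>U. Max {ereal (dist x x1), ereal (dist x x2), (\<phi>1 x + \<phi>2 x) - \<phi>1 x1 - \<phi>2 x2})"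

definition Theta_circ ::
  "'a::metric_space set \<Rightarrow> ('a \<Rightarrow> ereal) \<Rightarrow> ('a \<Rightarrow> ereal) \<Rightarrow> ereal" where
  "Theta_circ U \<phi>1 \<phi>2 = dist_limsup (edom \<phi>1 \<inter> U) (edom \<phi>2 \<inter> U) (diamond U \<phi>1 \<phi>2)"

definition Theta_dag ::
  "'a::metric_space set \<Rightarrow> ('a \<Rightarrow> ereal) \<Rightarrow> ('a \<Rightarrow> ereal) \<Rightarrow> ereal" where
  "Theta_dag U \<phi>1 \<phi>2 =
     (SUP V\<in>EI U. dist_limsup (edom \<phi>1 \<inter> V) (edom \<phi>2 \<inter> V) (diamond U \<phi>1 \<phi>2))"

definition uniformly_lsc ::
  "'a::metric_space set \<Rightarrow> ('a \<Rightarrow> ereal) \<Rightarrow> ('a \<Rightarrow> ereal) \<Rightarrow> bool" where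
  "uniformly_lsc U \<phi>1 \<phi>2 \<longleftrightarrow> (INF x\<in>U. \<phi>1 x + \<phi>2 x) \<le> Lambda_circ U \<phi>1 \<phi>2"

definition quasiuniformly_lsc ::
  "'a::metric_space set \<Rightarrow> ('a \<Rightarrow> ereal) \<Rightarrow> ('a \<Rightarrow> ereal) \<Rightarrow> bool" where
  "quasiuniformly_lsc U \<phi>1 \<phi>2 \<longleftrightarrow> (INF x\<in>U. \<phi>1 x + \<phi>2 x) \<le> Lambda_dag U \<phi>1 \<phi>2"

definition firmly_uniformly_lsc ::
  "'a::metric_space set \<Rightarrow> ('a \<Rightarrow> ereal) \<Rightarrow> ('a \<Rightarrow> ereal) \<Rightarrow> bool" where
  "firmly_uniformly_lsc U \<phi>1 \<phi>2 \<longleftrightarrow> Theta_circ U \<phi>1 \<phi>2 = 0"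

definition firmly_quasiuniformly_lsc ::
  "'a::metric_space set \<Rightarrow> ('a \<Rightarrow> ereal) \<Rightarrow> ('a \<Rightarrow> ereal) \<Rightarrow> bool" where
  "firmly_quasiuniformly_lsc U \<phi>1 \<phi>2 \<longleftrightarrow> Theta_dag U \<phi>1 \<phi>2 = 0"

definition cond_a ::
  "(nat \<Rightarrow> 'a::metric_space) \<Rightarrow> (nat \<Rightarrow> 'a) \<Rightarrow> (nat \<Rightarrow> 'a) \<Rightarrow> bool" where
  "cond_a x x1 x2 \<longleftrightarrow>
     (\<lambda>k. dist (x k) (x1 k)) \<longlonglongrightarrow> 0 \<and> (\<lambda>k. dist (x k) (x2 k)) \<longlonglongrightarrow> 0"

definition cond_b ::
  "('a \<Rightarrow> ereal) \<Rightarrow> ('a \<Rightarrow> ereal) \<Rightarrow>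
     (nat \<Rightarrow> 'a) \<Rightarrow> (nat \<Rightarrow> 'a) \<Rightarrow> (nat \<Rightarrow> 'a) \<Rightarrow> bool" where
  "cond_b \<phi>1 \<phi>2 x x1 x2 \<longleftrightarrow>
     limsup (\<lambda>k. (\<phi>1 (x k) + \<phi>2 (x k)) - \<phi>1 (x1 k) - \<phi>2 (x2 k)) \<le> 0"

end

theory Submission
  imports Defs
begin

text \<open>Each of the four properties says that some quantity \<open>g x x1 x2\<close>, minimised over \<open>x\<close>,
  becomes small as soon as \<open>x1\<close> and \<open>x2\<close> are close. For the two plain notions \<open>g\<close> is the excess
  \<open>(\<phi>1 + \<phi>2) x - \<phi>1 x1 - \<phi>2 x2\<close>; for the two firm ones it is the maximum of this excess and of the
  distances from \<open>x\<close> to \<open>x1\<close> and \<open>x2\<close>. The proof passes through this \<open>\<epsilon>\<close>-\<open>\<eta>\<close> form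
  (\<open>eventually_small\<close>).

  Once the form is reached, the sequential criterion is the same for every \<open>g\<close>
  (\<open>eventually_small_iff_sequences\<close>): along given sequences a nearly optimal \<open>x k\<close> works, and if
  the form fails for some \<open>\<epsilon>\<close>, the offending pairs with \<open>\<eta> = 1 / (n + 1)\<close> make up a pair of
  sequences for which no \<open>x\<close> exists.

  That the form is reached is immediate from the definition for the firm notions
  (\<open>dist_limsup_diamond_le_iff\<close>). For the plain ones (\<open>Inf_le_Lambda_circ_iff\<close>) the point is that
  the excess of a point \<open>x\<close> that almost minimises \<open>\<phi>1 + \<phi>2\<close> on \<open>U\<close> is small exactly when
  \<open>\<phi>1 x1 + \<phi>2 x2\<close> is not much below the infimum.

  The quasiuniform notions quantify over all essentially interior sets \<open>V\<close> and keep both points in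
  \<open>V\<close>, whereas the sequential criterion only asks this of the first sequence. Since \<open>V\<close> can be
  enlarged by a small margin inside \<open>EI U\<close>, a second point close to the first is in the enlarged
  set automatically, which reconciles the two (\<open>eventually_small_EI_iff\<close>). The same margin
  forces \<open>x\<close> into \<open>U\<close> when it is close to \<open>x1\<close>, so in the firm case \<open>x\<close> may range over the whole
  space (\<open>eventually_small_firm_UNIV_iff\<close>).\<close>

section \<open>Smallness for nearby points and its sequential form\<close>

definition eventually_small ::
  "('a::metric_space \<Rightarrow> 'a \<Rightarrow> 'a \<Rightarrow> ereal) \<Rightarrow> 'a set \<Rightarrow> 'a set \<Rightarrow> 'a set \<Rightarrow> bool" where
  "eventually_small g A B C \<longleftrightarrow>
     (\<forall>\<epsilon>>0. \<exists>\<eta>>0. \<forall>x1\<in>A. \<forall>x2\<in>B. dist x1 x2 < \<eta> \<longrightarrow> (\<exists>x\<in>C. g x x1 x2 < ereal \<epsilon>))"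

lemma eventually_smallD:
  assumes "eventually_small g A B C" "\<epsilon> > 0"
  obtains \<eta> where "\<eta> > 0"
    "\<And>x1 x2. x1 \<in> A \<Longrightarrow> x2 \<in> B \<Longrightarrow> dist x1 x2 < \<eta> \<Longrightarrow> \<exists>x\<in>C. g x x1 x2 < ereal \<epsilon>"
  using assms unfolding eventually_small_def by blast

lemma eventually_small_mono:
  assumes "eventually_small g A B C" "A' \<subseteq> A" "B' \<subseteq> B" "C \<subseteq> C'"
  shows "eventually_small g A' B' C'"
  unfolding eventually_small_def
proof (intro allI impI)
  fix \<epsilon> :: real assume "\<epsilon> > 0"
  then obtain \<eta> where "\<eta> > 0" "\<And>x1 x2. x1 \<in> A \<Longrightarrow> x2 \<in> B \<Longrightarrow> dist x1 x2 < \<eta> \<Longrightarrow>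
      \<exists>x\<in>C. g x x1 x2 < ereal \<epsilon>"
    using eventually_smallD[OF assms(1)] by blast
  then show "\<exists>\<eta>>0. \<forall>x1\<in>A'. \<forall>x2\<in>B'. dist x1 x2 < \<eta> \<longrightarrow> (\<exists>x\<in>C'. g x x1 x2 < ereal \<epsilon>)"
    using assms(2-4) by (intro exI[of _ \<eta>]) blast
qed

lemma limsup_le_0_iff:
  fixes f :: "nat \<Rightarrow> ereal"
  shows "limsup f \<le> 0 \<longleftrightarrow> (\<forall>\<epsilon>>0. \<forall>\<^sub>F k in sequentially. f k < ereal \<epsilon>)"
proof
  assume "limsup f \<le> 0"
  then show "\<forall>\<epsilon>>0. \<forall>\<^sub>F k in sequentially. f k < ereal \<epsilon>"
    by (auto simp: Limsup_le_iff)
next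
  assume R: "\<forall>\<epsilon>>0. \<forall>\<^sub>F k in sequentially. f k < ereal \<epsilon>"
  have "limsup f \<le> 0 + ereal \<epsilon>" if "\<epsilon> > 0" for \<epsilon>
    using R that by (auto intro!: Limsup_bounded elim!: eventually_mono intro: less_imp_le)
  then show "limsup f \<le> 0"
    by (rule ereal_le_epsilon2)
qed

text \<open>The infimum of \<open>h\<close> may be \<open>-\<infinity>\<close> or \<open>\<infinity>\<close>, hence the truncation at \<open>0\<close> and the
  non-strict inequality.\<close>

lemma exists_near_minimizer:
  fixes h :: "'a \<Rightarrow> ereal"
  assumes "C \<noteq> {}" "\<delta> > 0"
  obtains x where "x \<in> C" "h x \<le> max 0 (INF y\<in>C. h y) + ereal \<delta>"
proof (cases "(INF y\<in>C. h y) = \<infinity>")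
  case True
  with that assms show ?thesis by auto
next
  case False
  let ?M = "max 0 (INF y\<in>C. h y)"
  have "\<bar>?M\<bar> \<noteq> \<infinity>"
    using False by (auto simp: max_def)
  then have "?M < ?M + ereal \<delta>"
    using \<open>\<delta> > 0\<close> by (cases ?M) auto
  then have "(INF y\<in>C. h y) < ?M + ereal \<delta>"
    by (meson le_less_trans max.cobounded2)
  then show ?thesis
    using that by (auto simp: INF_less_iff intro: less_imp_le)
qed

text \<open>In the forward direction the point \<open>x k\<close> has to be chosen before \<open>\<epsilon>\<close> is known, which is why
  it is a near minimiser and not just a witness for one \<open>\<epsilon>\<close>.\<close>

lemma eventually_small_iff_sequences:
  fixes A B C :: "'a::metric_space set"
  assumes "C \<noteq> {}"
  shows "eventually_small g A B C \<longleftrightarrow>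
    (\<forall>x1 x2 :: nat \<Rightarrow> 'a. range x1 \<subseteq> A \<and> range x2 \<subseteq> B \<and> (\<lambda>k. dist (x1 k) (x2 k)) \<longlonglongrightarrow> 0 \<longrightarrow>
       (\<exists>x :: nat \<Rightarrow> 'a. range x \<subseteq> C \<and> limsup (\<lambda>k. g (x k) (x1 k) (x2 k)) \<le> 0))"
  (is "?L \<longleftrightarrow> ?R")
proof
  assume L: ?L
  show ?R
  proof (intro allI impI, elim conjE)
    fix x1 x2 :: "nat \<Rightarrow> 'a"
    assume A: "range x1 \<subseteq> A" and B: "range x2 \<subseteq> B"
      and lim: "(\<lambda>k. dist (x1 k) (x2 k)) \<longlonglongrightarrow> 0"
    let ?I = "\<lambda>k. INF y\<in>C. g y (x1 k) (x2 k)"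
    have "\<exists>x. x \<in> C \<and> g x (x1 k) (x2 k) \<le> max 0 (?I k) + ereal (1 / real (Suc k))" for k
      using exists_near_minimizer[OF assms, of "1 / real (Suc k)" "\<lambda>x. g x (x1 k) (x2 k)"] by auto
    then obtain x where x: "\<And>k. x k \<in> C"
      "\<And>k. g (x k) (x1 k) (x2 k) \<le> max 0 (?I k) + ereal (1 / real (Suc k))"
      by metis
    have "\<forall>\<^sub>F k in sequentially. g (x k) (x1 k) (x2 k) < ereal \<epsilon>" if "\<epsilon> > 0" for \<epsilon>
    proof -
      obtain \<eta> where \<eta>: "\<eta> > 0"
        "\<And>a b. a \<in> A \<Longrightarrow> b \<in> B \<Longrightarrow> dist a b < \<eta> \<Longrightarrow> \<exists>x\<in>C. g x a b < ereal (\<epsilon>/2)"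
        using eventually_smallD[OF L, of "\<epsilon>/2"] \<open>\<epsilon> > 0\<close> by auto
      have "\<forall>\<^sub>F k in sequentially. dist (x1 k) (x2 k) < \<eta>"
        using order_tendstoD(2)[OF lim \<open>\<eta> > 0\<close>] .
      moreover have "\<forall>\<^sub>F k in sequentially. 1 / real (Suc k) < \<epsilon>/2"
        using order_tendstoD(2)[OF lim_inverse_n'[THEN LIMSEQ_Suc], of "\<epsilon>/2"] \<open>\<epsilon> > 0\<close> by simp
      ultimately show ?thesis
      proof eventually_elim
        case (elim k)
        have "?I k < ereal (\<epsilon>/2)"
          using \<eta>(2)[OF _ _ elim(1)] A B unfolding INF_less_iff by (simp add: image_subset_iff)
        then have "max 0 (?I k) \<le> ereal (\<epsilon>/2)"
          using \<open>\<epsilon> > 0\<close> by auto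
        then have "max 0 (?I k) + ereal (1 / real (Suc k)) \<le> ereal (\<epsilon>/2) + ereal (1 / real (Suc k))"
          by (rule add_right_mono)
        also have "\<dots> < ereal \<epsilon>"
          using elim(2) by simp
        finally show ?case
          using x(2)[of k] by (meson le_less_trans)
      qed
    qed
    then show "\<exists>x. range x \<subseteq> C \<and> limsup (\<lambda>k. g (x k) (x1 k) (x2 k)) \<le> 0"
      unfolding limsup_le_0_iff using x(1) by (intro exI[of _ x]) auto
  qed
next
  assume R: ?R
  show ?L
  proof (rule ccontr)
    assume "\<not> ?L"
    then obtain \<epsilon> where "\<epsilon> > 0" and
      no: "\<not> (\<exists>\<eta>>0. \<forall>a\<in>A. \<forall>b\<in>B. dist a b < \<eta> \<longrightarrow> (\<exists>x\<in>C. g x a b < ereal \<epsilon>))"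
      unfolding eventually_small_def by auto
    have ex: "\<exists>a\<in>A. \<exists>b\<in>B. dist a b < \<eta> \<and> (\<forall>x\<in>C. \<not> g x a b < ereal \<epsilon>)"
      if "\<eta> > 0" for \<eta>
      using no that by blast
    have "\<exists>a b. a \<in> A \<and> b \<in> B \<and> dist a b < 1 / real (Suc k) \<and> (\<forall>x\<in>C. \<not> g x a b < ereal \<epsilon>)" for k
      using ex[of "1 / real (Suc k)"] by auto
    then obtain x1 x2 :: "nat \<Rightarrow> 'a" where xs: "\<And>k. x1 k \<in> A" "\<And>k. x2 k \<in> B"
      "\<And>k. dist (x1 k) (x2 k) < 1 / real (Suc k)"
      "\<And>k x. x \<in> C \<Longrightarrow> \<not> g x (x1 k) (x2 k) < ereal \<epsilon>"
      by metis
    have "(\<lambda>k. dist (x1 k) (x2 k)) \<longlonglongrightarrow> 0"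
    proof (rule tendsto_sandwich[OF _ _ tendsto_const lim_inverse_n'[THEN LIMSEQ_Suc]])
      show "\<forall>\<^sub>F k in sequentially. dist (x1 k) (x2 k) \<le> 1 / real (Suc k)"
        by (intro always_eventually allI less_imp_le xs(3))
    qed simp
    moreover have "range x1 \<subseteq> A" "range x2 \<subseteq> B"
      using xs(1,2) by auto
    ultimately obtain x where x: "range x \<subseteq> C" "limsup (\<lambda>k. g (x k) (x1 k) (x2 k)) \<le> 0"
      using R by blast
    then have "\<forall>\<^sub>F k in sequentially. g (x k) (x1 k) (x2 k) < ereal \<epsilon>"
      using \<open>\<epsilon> > 0\<close> unfolding limsup_le_0_iff by blast
    then obtain k where "g (x k) (x1 k) (x2 k) < ereal \<epsilon>"
      unfolding eventually_sequentially by blast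
    with xs(4)[of "x k" k] x(1) show False by auto
  qed
qed

section \<open>The excess and the firm excess\<close>

definition excess :: "('a \<Rightarrow> ereal) \<Rightarrow> ('a \<Rightarrow> ereal) \<Rightarrow> 'a \<Rightarrow> 'a \<Rightarrow> 'a \<Rightarrow> ereal" where
  "excess \<phi>1 \<phi>2 x x1 x2 = (\<phi>1 x + \<phi>2 x) - \<phi>1 x1 - \<phi>2 x2"

definition firm_excess ::
  "('a::metric_space \<Rightarrow> ereal) \<Rightarrow> ('a \<Rightarrow> ereal) \<Rightarrow> 'a \<Rightarrow> 'a \<Rightarrow> 'a \<Rightarrow> ereal" where
  "firm_excess \<phi>1 \<phi>2 x x1 x2 =
     Max {ereal (dist x x1), ereal (dist x x2), excess \<phi>1 \<phi>2 x x1 x2}"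

lemma firm_excess_less_iff:
  "firm_excess \<phi>1 \<phi>2 x x1 x2 < ereal \<epsilon> \<longleftrightarrow>
     dist x x1 < \<epsilon> \<and> dist x x2 < \<epsilon> \<and> excess \<phi>1 \<phi>2 x x1 x2 < ereal \<epsilon>"
  by (simp add: firm_excess_def)

lemma cond_b_iff_limsup_excess:
  "cond_b \<phi>1 \<phi>2 x x1 x2 \<longleftrightarrow> limsup (\<lambda>k. excess \<phi>1 \<phi>2 (x k) (x1 k) (x2 k)) \<le> 0"
  by (simp add: cond_b_def excess_def)

lemma dist_tendsto_0_iff:
  "(\<lambda>k. dist (x k) (y k)) \<longlonglongrightarrow> 0 \<longleftrightarrow> (\<forall>\<epsilon>>0. \<forall>\<^sub>F k in sequentially. dist (x k) (y k) < \<epsilon>)"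
  by (simp add: tendsto_iff)

lemma cond_a_and_b_iff_limsup_firm_excess:
  "cond_a x x1 x2 \<and> cond_b \<phi>1 \<phi>2 x x1 x2 \<longleftrightarrow>
     limsup (\<lambda>k. firm_excess \<phi>1 \<phi>2 (x k) (x1 k) (x2 k)) \<le> 0"
  unfolding cond_a_def cond_b_iff_limsup_excess limsup_le_0_iff dist_tendsto_0_iff
    firm_excess_less_iff eventually_conj_iff
  by blast

lemma excess_less_iff:
  assumes "\<bar>\<phi>1 x1\<bar> \<noteq> \<infinity>" "\<bar>\<phi>2 x2\<bar> \<noteq> \<infinity>"
  shows "excess \<phi>1 \<phi>2 x x1 x2 < ereal \<epsilon> \<longleftrightarrow> \<phi>1 x + \<phi>2 x < ereal \<epsilon> + (\<phi>1 x1 + \<phi>2 x2)"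
proof -
  obtain a b where ab: "\<phi>1 x1 = ereal a" "\<phi>2 x2 = ereal b"
    using assms by auto
  have "s - ereal a - ereal b < ereal \<epsilon> \<longleftrightarrow> s < ereal \<epsilon> + (ereal a + ereal b)" for s
    by (cases s) auto
  then show ?thesis
    unfolding excess_def ab .
qed

section \<open>The \<open>\<epsilon>\<close>-\<open>\<eta>\<close> form of the semicontinuity properties\<close>

text \<open>If the lower limit is below \<open>c < d\<close> while the infimum is above \<open>d\<close>, pairs with
  \<open>\<phi>1 x1 + \<phi>2 x2 < c\<close> have excess at least \<open>d - c\<close> at every point of \<open>U\<close>. Conversely, near minimisers
  of \<open>\<phi>1 + \<phi>2\<close> have small excess; when the infimum is \<open>-\<infinity>\<close>, some point has negative excess whatever
  the pair is. An infimum \<open>\<infinity>\<close> has to be excluded, because the lower limit can be \<open>\<infinity>\<close> also in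
  the presence of arbitrarily close pairs with finite values.\<close>

lemma Inf_le_Lambda_circ_iff:
  fixes \<phi>1 \<phi>2 :: "'a::metric_space \<Rightarrow> ereal"
  assumes ninf: "\<And>x. \<phi>1 x \<noteq> -\<infinity>" "\<And>x. \<phi>2 x \<noteq> -\<infinity>"
    and ne: "edom \<phi>1 \<inter> edom \<phi>2 \<inter> U \<noteq> {}"
  shows "(INF x\<in>U. \<phi>1 x + \<phi>2 x) \<le> Lambda_circ V \<phi>1 \<phi>2 \<longleftrightarrow>
    eventually_small (excess \<phi>1 \<phi>2) (edom \<phi>1 \<inter> V) (edom \<phi>2 \<inter> V) U"
  (is "?m \<le> ?\<Lambda> \<longleftrightarrow> ?S")
proof
  assume le: "?m \<le> ?\<Lambda>"
  obtain u where u: "u \<in> edom \<phi>1" "u \<in> edom \<phi>2" "u \<in> U"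
    using ne by auto
  have "?m \<le> \<phi>1 u + \<phi>2 u"
    using u by (intro INF_lower)
  also have "\<dots> < \<infinity>"
    using u by (auto simp: edom_def)
  finally have m: "?m < \<infinity>" .
  show ?S
    unfolding eventually_small_def
  proof (intro allI impI)
    fix \<epsilon> :: real assume "\<epsilon> > 0"
    have "\<exists>\<eta>>0. \<forall>x1\<in>edom \<phi>1 \<inter> V. \<forall>x2\<in>edom \<phi>2 \<inter> V. dist x1 x2 < \<eta> \<longrightarrow>
        ?m < ereal \<epsilon> + (\<phi>1 x1 + \<phi>2 x2)"
    proof (cases "?m = -\<infinity>")
      case True
      have "?m < ereal \<epsilon> + (\<phi>1 x1 + \<phi>2 x2)" for x1 x2
        using ninf(1)[of x1] ninf(2)[of x2]
        unfolding True by (cases "\<phi>1 x1"; cases "\<phi>2 x2") auto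
      then show ?thesis
        by (intro exI[of _ 1]) auto
    next
      case False
      with m obtain r where r: "?m = ereal r"
        by (cases ?m) auto
      have "ereal (r - \<epsilon>) < ?\<Lambda>"
        using le r \<open>\<epsilon> > 0\<close> by (intro less_le_trans[OF _ le]) auto
      then obtain \<eta> where \<eta>: "\<eta> > 0"
        "ereal (r - \<epsilon>) < (INF (x1, x2)\<in>close_pairs V V \<eta>. \<phi>1 x1 + \<phi>2 x2)"
        unfolding Lambda_circ_def dist_liminf_eq_SUP by (auto simp: less_SUP_iff)
      have "?m < ereal \<epsilon> + (\<phi>1 x1 + \<phi>2 x2)"
        if "x1 \<in> V" "x2 \<in> V" "dist x1 x2 < \<eta>" for x1 x2
      proof -
        have "(x1, x2) \<in> close_pairs V V \<eta>"
          using that by (auto simp: close_pairs_def)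
        from INF_lower[OF this, of "\<lambda>(x1, x2). \<phi>1 x1 + \<phi>2 x2"] \<eta>(2)
        have "ereal (r - \<epsilon>) < \<phi>1 x1 + \<phi>2 x2"
          by (auto dest: less_le_trans)
        then show ?thesis
          unfolding r by (cases "\<phi>1 x1 + \<phi>2 x2") auto
      qed
      with \<open>\<eta> > 0\<close> show ?thesis by auto
    qed
    then obtain \<eta> where "\<eta> > 0" and \<eta>: "\<And>x1 x2. x1 \<in> edom \<phi>1 \<inter> V \<Longrightarrow> x2 \<in> edom \<phi>2 \<inter> V \<Longrightarrow>
        dist x1 x2 < \<eta> \<Longrightarrow> ?m < ereal \<epsilon> + (\<phi>1 x1 + \<phi>2 x2)"
      by blast
    have "\<exists>x\<in>U. excess \<phi>1 \<phi>2 x x1 x2 < ereal \<epsilon>"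
      if "x1 \<in> edom \<phi>1 \<inter> V" "x2 \<in> edom \<phi>2 \<inter> V" "dist x1 x2 < \<eta>" for x1 x2
    proof -
      have "\<bar>\<phi>1 x1\<bar> \<noteq> \<infinity>" "\<bar>\<phi>2 x2\<bar> \<noteq> \<infinity>"
        using that ninf(1)[of x1] ninf(2)[of x2] by (auto simp: edom_def)
      then show ?thesis
        using \<eta>[OF that] by (simp add: excess_less_iff INF_less_iff)
    qed
    with \<open>\<eta> > 0\<close> show "\<exists>\<eta>>0. \<forall>x1\<in>edom \<phi>1 \<inter> V. \<forall>x2\<in>edom \<phi>2 \<inter> V. dist x1 x2 < \<eta> \<longrightarrow>
        (\<exists>x\<in>U. excess \<phi>1 \<phi>2 x x1 x2 < ereal \<epsilon>)"
      by blast
  qed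
next
  assume S: ?S
  show "?m \<le> ?\<Lambda>"
  proof (rule ccontr)
    assume "\<not> ?m \<le> ?\<Lambda>"
    then have "?\<Lambda> < ?m" by simp
    then obtain c where c: "?\<Lambda> < ereal c" "ereal c < ?m"
      using ereal_dense2 by blast
    then obtain d where d: "ereal c < ereal d" "ereal d < ?m"
      using ereal_dense2 by blast
    obtain \<eta> where \<eta>: "\<eta> > 0" "\<And>x1 x2. x1 \<in> edom \<phi>1 \<inter> V \<Longrightarrow> x2 \<in> edom \<phi>2 \<inter> V \<Longrightarrow>
        dist x1 x2 < \<eta> \<Longrightarrow> \<exists>x\<in>U. excess \<phi>1 \<phi>2 x x1 x2 < ereal (d - c)"
      using eventually_smallD[OF S, of "d - c"] d(1) by auto
    have "(INF (x1, x2)\<in>close_pairs V V \<eta>. \<phi>1 x1 + \<phi>2 x2) \<le> ?\<Lambda>"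
      unfolding Lambda_circ_def dist_liminf_eq_SUP using \<open>\<eta> > 0\<close> by (intro SUP_upper) auto
    then have "(INF (x1, x2)\<in>close_pairs V V \<eta>. \<phi>1 x1 + \<phi>2 x2) < ereal c"
      using c(1) by (rule le_less_trans)
    then obtain x1 x2 where x12: "x1 \<in> V" "x2 \<in> V" "dist x1 x2 < \<eta>" "\<phi>1 x1 + \<phi>2 x2 < ereal c"
      by (auto simp: INF_less_iff close_pairs_def)
    have fin: "\<bar>\<phi>1 x1\<bar> \<noteq> \<infinity>" "\<bar>\<phi>2 x2\<bar> \<noteq> \<infinity>"
      using x12(4) ninf(1)[of x1] ninf(2)[of x2] by auto
    then obtain x where x: "x \<in> U" "excess \<phi>1 \<phi>2 x x1 x2 < ereal (d - c)"
      using \<eta>(2)[of x1 x2] x12 by (auto simp: edom_def)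
    have "\<phi>1 x + \<phi>2 x < ereal (d - c) + (\<phi>1 x1 + \<phi>2 x2)"
      using x(2) fin by (simp add: excess_less_iff)
    also have "\<dots> \<le> ereal (d - c) + ereal c"
      using x12(4) by (intro add_left_mono less_imp_le)
    also have "\<dots> = ereal d" by simp
    finally have "\<phi>1 x + \<phi>2 x < ?m"
      using d(2) by (rule less_trans)
    then show False
      using INF_lower[OF x(1), of "\<lambda>x. \<phi>1 x + \<phi>2 x"] by (simp add: not_le[symmetric])
  qed
qed

lemma dist_limsup_nonneg: "0 \<le> dist_limsup A B f"
  unfolding dist_limsup_eq_INF by (intro INF_greatest Sup_upper) auto

lemma dist_limsup_le_0_iff:
  "dist_limsup A B f \<le> 0 \<longleftrightarrow>
     (\<forall>\<epsilon>>0. \<exists>\<eta>>0. \<forall>x1\<in>A. \<forall>x2\<in>B. dist x1 x2 < \<eta> \<longrightarrow> f x1 x2 < ereal \<epsilon>)"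
  (is "?L \<longleftrightarrow> ?R")
proof
  assume L: ?L
  show ?R
  proof (intro allI impI)
    fix \<epsilon> :: real assume "\<epsilon> > 0"
    with L have "dist_limsup A B f < ereal \<epsilon>"
      by (auto intro: le_less_trans)
    then obtain \<eta> where \<eta>: "\<eta> > 0"
      "Sup (insert 0 ((\<lambda>(x1, x2). f x1 x2) ` close_pairs A B \<eta>)) < ereal \<epsilon>"
      unfolding dist_limsup_eq_INF by (auto simp: INF_less_iff)
    have "f x1 x2 < ereal \<epsilon>" if "x1 \<in> A" "x2 \<in> B" "dist x1 x2 < \<eta>" for x1 x2
    proof -
      have "(x1, x2) \<in> close_pairs A B \<eta>"
        using that by (simp add: close_pairs_def)
      then have "f x1 x2 \<le> Sup (insert 0 ((\<lambda>(x1, x2). f x1 x2) ` close_pairs A B \<eta>))"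
        by (intro Sup_upper insertI2) force
      then show ?thesis
        using \<eta>(2) by (rule le_less_trans)
    qed
    with \<open>\<eta> > 0\<close> show "\<exists>\<eta>>0. \<forall>x1\<in>A. \<forall>x2\<in>B. dist x1 x2 < \<eta> \<longrightarrow> f x1 x2 < ereal \<epsilon>"
      by blast
  qed
next
  assume R: ?R
  have "dist_limsup A B f \<le> 0 + ereal \<epsilon>" if "\<epsilon> > 0" for \<epsilon>
  proof -
    obtain \<eta> where \<eta>: "\<eta> > 0"
      "\<And>x1 x2. x1 \<in> A \<Longrightarrow> x2 \<in> B \<Longrightarrow> dist x1 x2 < \<eta> \<Longrightarrow> f x1 x2 < ereal \<epsilon>"
      using R \<open>\<epsilon> > 0\<close> by meson
    have "dist_limsup A B f \<le> Sup (insert 0 ((\<lambda>(x1, x2). f x1 x2) ` close_pairs A B \<eta>))"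
      unfolding dist_limsup_eq_INF using \<open>\<eta> > 0\<close> by (intro INF_lower) auto
    also have "\<dots> \<le> ereal \<epsilon>"
      using \<eta>(2) \<open>\<epsilon> > 0\<close> by (intro Sup_least) (auto simp: close_pairs_def less_imp_le)
    finally show ?thesis by simp
  qed
  then show ?L
    by (rule ereal_le_epsilon2)
qed

lemma dist_limsup_diamond_le_iff:
  "dist_limsup A B (diamond U \<phi>1 \<phi>2) \<le> 0 \<longleftrightarrow> eventually_small (firm_excess \<phi>1 \<phi>2) A B U"
proof -
  have "diamond U \<phi>1 \<phi>2 x1 x2 < ereal \<epsilon> \<longleftrightarrow> (\<exists>x\<in>U. firm_excess \<phi>1 \<phi>2 x x1 x2 < ereal \<epsilon>)"
    for x1 x2 \<epsilon>
    unfolding diamond_def firm_excess_def excess_def by (rule INF_less_iff)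
  then show ?thesis
    unfolding dist_limsup_le_0_iff eventually_small_def by simp
qed

section \<open>Essentially interior sets\<close>

lemma EI_subset: "V \<in> EI U \<Longrightarrow> W \<subseteq> V \<Longrightarrow> W \<in> EI U"
  unfolding EI_def by blast

lemma EI_imp_subset: "V \<in> EI U \<Longrightarrow> V \<subseteq> U"
  unfolding EI_def by force

text \<open>Half of the margin of \<open>V\<close> is used for the enlargement, the other half remains as the margin of
  the enlarged set.\<close>

lemma EI_enlarge:
  assumes "V \<in> EI U"
  obtains W \<rho> where "W \<in> EI U" "V \<subseteq> W" "\<rho> > 0" "\<And>x y. x \<in> V \<Longrightarrow> dist x y < \<rho> \<Longrightarrow> y \<in> W"
proof -
  obtain \<rho> where \<rho>: "\<rho> > 0" "(\<Union>x\<in>V. ball x \<rho>) \<subseteq> U"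
    using assms unfolding EI_def by blast
  let ?W = "\<Union>x\<in>V. ball x (\<rho>/2)"
  have "ball y (\<rho>/2) \<subseteq> U" if "x \<in> V" "y \<in> ball x (\<rho>/2)" for x y
  proof
    fix z assume "z \<in> ball y (\<rho>/2)"
    then have "dist x z < \<rho>"
      using that(2) dist_triangle_half_r[of y x \<rho> z] by (auto simp: dist_commute)
    with \<rho>(2) that(1) show "z \<in> U"
      by (meson UN_subset_iff mem_ball subsetD)
  qed
  then have "(\<Union>y\<in>?W. ball y (\<rho>/2)) \<subseteq> U"
    by blast
  moreover have "\<rho>/2 > 0"
    using \<rho>(1) by simp
  ultimately have "?W \<in> EI U"
    unfolding EI_def by blast
  moreover have "V \<subseteq> ?W"
    using \<rho>(1) by auto
  ultimately show ?thesis
    using \<rho>(1) by (intro that[of ?W "\<rho>/2"]) auto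
qed

text \<open>For the nontrivial direction, \<open>\<eta>\<close> is cut down to the margin by which a larger essentially
  interior set \<open>W\<close> surrounds \<open>V\<close>; then \<open>x1 \<in> V\<close> forces \<open>x2 \<in> W\<close>.\<close>

lemma eventually_small_EI_iff:
  "(\<forall>V\<in>EI U. eventually_small g (D1 \<inter> V) (D2 \<inter> V) C) \<longleftrightarrow>
   (\<forall>V\<in>EI U. eventually_small g (D1 \<inter> V) D2 C)"
proof (intro iffI ballI)
  fix V
  assume L: "\<forall>V\<in>EI U. eventually_small g (D1 \<inter> V) (D2 \<inter> V) C" and "V \<in> EI U"
  then obtain W \<rho> where W: "W \<in> EI U" "V \<subseteq> W" "\<rho> > 0"
    "\<And>x y. x \<in> V \<Longrightarrow> dist x y < \<rho> \<Longrightarrow> y \<in> W"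
    using EI_enlarge by blast
  show "eventually_small g (D1 \<inter> V) D2 C"
    unfolding eventually_small_def
  proof (intro allI impI)
    fix \<epsilon> :: real assume "\<epsilon> > 0"
    then obtain \<eta> where "\<eta> > 0" and \<eta>: "\<And>x1 x2. x1 \<in> D1 \<inter> W \<Longrightarrow> x2 \<in> D2 \<inter> W \<Longrightarrow>
        dist x1 x2 < \<eta> \<Longrightarrow> \<exists>x\<in>C. g x x1 x2 < ereal \<epsilon>"
      using eventually_smallD[OF bspec[OF L W(1)]] by blast
    then show "\<exists>\<eta>>0. \<forall>x1\<in>D1 \<inter> V. \<forall>x2\<in>D2. dist x1 x2 < \<eta> \<longrightarrow> (\<exists>x\<in>C. g x x1 x2 < ereal \<epsilon>)"
      using W by (intro exI[of _ "min \<eta> \<rho>"]) auto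
  qed
qed (auto intro: eventually_small_mono)

text \<open>The firm excess dominates \<open>dist x x1\<close>, so a value below the margin of \<open>V\<close> in \<open>U\<close> puts \<open>x\<close>
  into \<open>U\<close>; it is therefore enough to shrink \<open>\<epsilon>\<close>.\<close>

lemma eventually_small_firm_UNIV_iff:
  assumes "V \<in> EI U"
  shows "eventually_small (firm_excess \<phi>1 \<phi>2) (D \<inter> V) B U \<longleftrightarrow>
    eventually_small (firm_excess \<phi>1 \<phi>2) (D \<inter> V) B UNIV"
proof
  assume S: "eventually_small (firm_excess \<phi>1 \<phi>2) (D \<inter> V) B UNIV"
  obtain \<rho> where \<rho>: "\<rho> > 0" "\<And>x y. x \<in> V \<Longrightarrow> dist y x < \<rho> \<Longrightarrow> y \<in> U"
    using EI_enlarge[OF assms] EI_imp_subset by (metis dist_commute subsetD)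
  show "eventually_small (firm_excess \<phi>1 \<phi>2) (D \<inter> V) B U"
    unfolding eventually_small_def
  proof (intro allI impI)
    fix \<epsilon> :: real assume "\<epsilon> > 0"
    then obtain \<eta> where "\<eta> > 0" and \<eta>: "\<And>x1 x2. x1 \<in> D \<inter> V \<Longrightarrow> x2 \<in> B \<Longrightarrow>
        dist x1 x2 < \<eta> \<Longrightarrow> \<exists>x\<in>UNIV. firm_excess \<phi>1 \<phi>2 x x1 x2 < ereal (min \<epsilon> \<rho>)"
      using eventually_smallD[OF S, of "min \<epsilon> \<rho>"] \<rho>(1) by auto
    have "\<exists>x\<in>U. firm_excess \<phi>1 \<phi>2 x x1 x2 < ereal \<epsilon>"
      if x12: "x1 \<in> D \<inter> V" "x2 \<in> B" "dist x1 x2 < \<eta>" for x1 x2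
    proof -
      obtain x where x: "firm_excess \<phi>1 \<phi>2 x x1 x2 < ereal (min \<epsilon> \<rho>)"
        using \<eta>[OF x12] by blast
      then have "x \<in> U"
        using \<rho>(2)[of x1 x] x12 by (simp add: firm_excess_less_iff)
      moreover have "firm_excess \<phi>1 \<phi>2 x x1 x2 < ereal \<epsilon>"
        using x by (rule less_le_trans) simp
      ultimately show ?thesis by blast
    qed
    with \<open>\<eta> > 0\<close> show "\<exists>\<eta>>0. \<forall>x1\<in>D \<inter> V. \<forall>x2\<in>B. dist x1 x2 < \<eta> \<longrightarrow>
        (\<exists>x\<in>U. firm_excess \<phi>1 \<phi>2 x x1 x2 < ereal \<epsilon>)"
      by blast
  qed
qed (auto intro: eventually_small_mono)

text \<open>A sequence lies in some essentially interior set exactly when its range is essentially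
  interior, so the quantification over \<open>V\<close> disappears.\<close>

lemma eventually_small_EI_iff_sequences:
  fixes U :: "'a::metric_space set"
  assumes "C \<noteq> {}"
  shows "(\<forall>V\<in>EI U. eventually_small g (D1 \<inter> V) D2 C) \<longleftrightarrow>
    (\<forall>x1 x2 :: nat \<Rightarrow> 'a. range x1 \<subseteq> D1 \<inter> U \<and> range x2 \<subseteq> D2 \<and> range x1 \<in> EI U \<and>
       (\<lambda>k. dist (x1 k) (x2 k)) \<longlonglongrightarrow> 0 \<longrightarrow>
       (\<exists>x :: nat \<Rightarrow> 'a. range x \<subseteq> C \<and> limsup (\<lambda>k. g (x k) (x1 k) (x2 k)) \<le> 0))"
  (is "?L \<longleftrightarrow> ?R")
proof
  assume L: ?L
  show ?R
  proof (intro allI impI, elim conjE)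
    fix x1 x2 :: "nat \<Rightarrow> 'a"
    assume "range x1 \<subseteq> D1 \<inter> U" "range x2 \<subseteq> D2" "(\<lambda>k. dist (x1 k) (x2 k)) \<longlonglongrightarrow> 0"
      and EI: "range x1 \<in> EI U"
    moreover have "eventually_small g (D1 \<inter> range x1) D2 C"
      using L EI by blast
    ultimately show "\<exists>x. range x \<subseteq> C \<and> limsup (\<lambda>k. g (x k) (x1 k) (x2 k)) \<le> 0"
      unfolding eventually_small_iff_sequences[OF assms] by blast
  qed
next
  assume R: ?R
  show ?L
    unfolding eventually_small_iff_sequences[OF assms]
  proof (intro ballI allI impI, elim conjE)
    fix V and x1 x2 :: "nat \<Rightarrow> 'a"
    assume V: "V \<in> EI U" and x1: "range x1 \<subseteq> D1 \<inter> V"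
      and x2: "range x2 \<subseteq> D2" "(\<lambda>k. dist (x1 k) (x2 k)) \<longlonglongrightarrow> 0"
    have "range x1 \<in> EI U" "range x1 \<subseteq> D1 \<inter> U"
      using EI_subset[OF V, of "range x1"] EI_imp_subset[OF V] x1 by blast+
    with R x2 show "\<exists>x. range x \<subseteq> C \<and> limsup (\<lambda>k. g (x k) (x1 k) (x2 k)) \<le> 0"
      by blast
  qed
qed

theorem proposition4p5:
  fixes \<phi>1 \<phi>2 :: "'a::metric_space \<Rightarrow> ereal" and U :: "'a set"
  assumes "\<And>x. \<phi>1 x \<noteq> -\<infinity>" and "\<And>x. \<phi>2 x \<noteq> -\<infinity>"
    and "edom \<phi>1 \<inter> edom \<phi>2 \<inter> U \<noteq> {}"
  shows
    "(uniformly_lsc U \<phi>1 \<phi>2 \<longleftrightarrow>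
        (\<forall>x1 x2 :: nat \<Rightarrow> 'a.
           range x1 \<subseteq> edom \<phi>1 \<inter> U \<and> range x2 \<subseteq> edom \<phi>2 \<inter> U \<and>
           (\<lambda>k. dist (x1 k) (x2 k)) \<longlonglongrightarrow> 0 \<longrightarrow>
           (\<exists>x :: nat \<Rightarrow> 'a. range x \<subseteq> U \<and> cond_b \<phi>1 \<phi>2 x x1 x2))) \<and>
     (quasiuniformly_lsc U \<phi>1 \<phi>2 \<longleftrightarrow>
        (\<forall>x1 x2 :: nat \<Rightarrow> 'a.
           range x1 \<subseteq> edom \<phi>1 \<inter> U \<and> range x2 \<subseteq> edom \<phi>2 \<and> range x1 \<in> EI U \<and>
           (\<lambda>k. dist (x1 k) (x2 k)) \<longlonglongrightarrow> 0 \<longrightarrow>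
           (\<exists>x :: nat \<Rightarrow> 'a. range x \<subseteq> U \<and> cond_b \<phi>1 \<phi>2 x x1 x2))) \<and>
     (firmly_uniformly_lsc U \<phi>1 \<phi>2 \<longleftrightarrow>
        (\<forall>x1 x2 :: nat \<Rightarrow> 'a.
           range x1 \<subseteq> edom \<phi>1 \<inter> U \<and> range x2 \<subseteq> edom \<phi>2 \<inter> U \<and>
           (\<lambda>k. dist (x1 k) (x2 k)) \<longlonglongrightarrow> 0 \<longrightarrow>
           (\<exists>x :: nat \<Rightarrow> 'a. range x \<subseteq> U \<and> cond_a x x1 x2 \<and> cond_b \<phi>1 \<phi>2 x x1 x2))) \<and>
     (firmly_quasiuniformly_lsc U \<phi>1 \<phi>2 \<longleftrightarrow>
        (\<forall>x1 x2 :: nat \<Rightarrow> 'a.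
           range x1 \<subseteq> edom \<phi>1 \<inter> U \<and> range x2 \<subseteq> edom \<phi>2 \<and> range x1 \<in> EI U \<and>
           (\<lambda>k. dist (x1 k) (x2 k)) \<longlonglongrightarrow> 0 \<longrightarrow>
           (\<exists>x :: nat \<Rightarrow> 'a. cond_a x x1 x2 \<and> cond_b \<phi>1 \<phi>2 x x1 x2)))"
proof -
  note ninf = assms(1,2) and ne = assms(3)
  have U: "U \<noteq> {}" using ne by blast
  let ?e = "excess \<phi>1 \<phi>2" and ?f = "firm_excess \<phi>1 \<phi>2"
  let ?D1 = "edom \<phi>1" and ?D2 = "edom \<phi>2"
  have i: "uniformly_lsc U \<phi>1 \<phi>2 \<longleftrightarrow> eventually_small ?e (?D1 \<inter> U) (?D2 \<inter> U) U"
    unfolding uniformly_lsc_def using Inf_le_Lambda_circ_iff[OF ninf ne] .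
  have ii: "quasiuniformly_lsc U \<phi>1 \<phi>2 \<longleftrightarrow> (\<forall>V\<in>EI U. eventually_small ?e (?D1 \<inter> V) ?D2 U)"
    unfolding quasiuniformly_lsc_def Lambda_dag_def le_INF_iff
      Inf_le_Lambda_circ_iff[OF ninf ne] eventually_small_EI_iff ..
  have iii: "firmly_uniformly_lsc U \<phi>1 \<phi>2 \<longleftrightarrow> eventually_small ?f (?D1 \<inter> U) (?D2 \<inter> U) U"
    unfolding firmly_uniformly_lsc_def Theta_circ_def dist_limsup_diamond_le_iff[symmetric]
    using dist_limsup_nonneg by (auto intro: antisym)
  have "{} \<in> EI U"
    unfolding EI_def by (auto intro: exI[of _ 1])
  then have "0 \<le> Theta_dag U \<phi>1 \<phi>2"
    unfolding Theta_dag_def by (rule SUP_upper2) (rule dist_limsup_nonneg)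
  then have "firmly_quasiuniformly_lsc U \<phi>1 \<phi>2 \<longleftrightarrow> Theta_dag U \<phi>1 \<phi>2 \<le> 0"
    unfolding firmly_quasiuniformly_lsc_def by (auto intro: antisym)
  also have "\<dots> \<longleftrightarrow> (\<forall>V\<in>EI U. eventually_small ?f (?D1 \<inter> V) ?D2 U)"
    unfolding Theta_dag_def SUP_le_iff dist_limsup_diamond_le_iff eventually_small_EI_iff ..
  also have "\<dots> \<longleftrightarrow> (\<forall>V\<in>EI U. eventually_small ?f (?D1 \<inter> V) ?D2 UNIV)"
    using eventually_small_firm_UNIV_iff by blast
  finally have iv: "firmly_quasiuniformly_lsc U \<phi>1 \<phi>2 \<longleftrightarrow>
    (\<forall>V\<in>EI U. eventually_small ?f (?D1 \<inter> V) ?D2 UNIV)" .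
  show ?thesis
    unfolding i ii iii iv cond_a_and_b_iff_limsup_firm_excess
    unfolding cond_b_iff_limsup_excess
      eventually_small_EI_iff_sequences[OF U]
      eventually_small_EI_iff_sequences[OF UNIV_not_empty]
    unfolding eventually_small_iff_sequences[OF U]
    by simp
qed

end
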